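(* Let $f\colon S^1\to S^1$ be any continuous map. Then $$\mathrm{MMR}[f]=\begin{cases} |\deg f|, & \deg f\neq 0,\\ 2, & \deg f=0.\end{cases}$$
   Context: For a continuous map $f\colon X\to Y$ between topological spaces, the multiplicity of $f$ is $\max_{y\in Y}|f^{-1}(y)|$ (with value $\infty$ if the cardinalities are not bounded by a finite number). The minimal multiplicity of $f$ is $$\mathrm{MMR}[f]:=\min_{g\simeq f}\ \max_{y\in Y}|g^{-1}(y)|,$$ where $g$ ranges over all continuous maps $X\to Y$ that are (freely) homotopic to $f$, and $|\cdot|$ denotes cardinality. $\deg f\in\mathbb{Z}$ is the usual degree of a self-map of the circle. *)

theory Defs
  imports "HOL-Analysis.Analysis" "HOL-Library.Extended_Nat"
begin

section \<open>Multiplicity and minimal multiplicity\<close>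

definition ecard :: "'a set \<Rightarrow> enat" where
  "ecard A = (if finite A then enat (card A) else \<infinity>)"

text \<open>In \<^typ>\<open>enat\<close> a bounded supremum over a nonempty set is a maximum and an unbounded one
  is \<open>\<infinity>\<close>.\<close>

definition multiplicity_map :: "'a topology \<Rightarrow> 'b topology \<Rightarrow> ('a \<Rightarrow> 'b) \<Rightarrow> enat" where
  "multiplicity_map X Y g = (SUP y \<in> topspace Y. ecard {x \<in> topspace X. g x = y})"

text \<open>Since \<^typ>\<open>enat\<close> is well-ordered and \<open>f\<close> is homotopic to itself when it is continuous, the
  infimum is a minimum. The relation \<^term>\<open>homotopic_with (\<lambda>_. True) X Y\<close> is free homotopy; it
  entails that both maps are continuous.\<close>

definition MMR :: "'a topology \<Rightarrow> 'b topology \<Rightarrow> ('a \<Rightarrow> 'b) \<Rightarrow> enat" where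
  "MMR X Y f = (INF g \<in> {g. homotopic_with (\<lambda>_. True) X Y f g}. multiplicity_map X Y g)"


section \<open>Degree of a self-map of the circle\<close>

abbreviation circle :: "complex topology" where
  "circle \<equiv> top_of_set (sphere 0 1)"

text \<open>\<open>F\<close> is a lift of \<open>f\<close> along the universal covering \<open>t \<mapsto> exp(2\<pi>it)\<close> of the circle, and
  \<open>d\<close> is its increment over one period.\<close>

definition lift_with_degree :: "(complex \<Rightarrow> complex) \<Rightarrow> (real \<Rightarrow> real) \<Rightarrow> int \<Rightarrow> bool" where
  "lift_with_degree f F d \<longleftrightarrow>
     continuous_on UNIV F \<and>
     (\<forall>t. f (cis (2 * pi * t)) = cis (2 * pi * F t)) \<and>
     (\<forall>t. F (t + 1) = F t + of_int d)"

definition circle_degree :: "(complex \<Rightarrow> complex) \<Rightarrow> int" where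
  "circle_degree f = (THE d. \<exists>F. lift_with_degree f F d)"

lemma cis_eq_imp_diff_Ints:
  assumes "cis (2 * pi * a) = cis (2 * pi * b)"
  shows "a - b \<in> \<int>"
proof -
  have "cis (2 * pi * (a - b)) = 1"
    using assms by (simp add: right_diff_distrib flip: cis_divide)
  hence "cos (2 * pi * (a - b)) = 1"
    by (simp add: complex_eq_iff)
  then obtain n :: int where "2 * pi * (a - b) = of_int n * 2 * pi"
    using cos_one_2pi_int by auto
  hence "a - b = of_int n" by simp
  thus ?thesis by simp
qed

lemma continuous_Ints_constant:
  fixes h :: "real \<Rightarrow> real"
  assumes "continuous_on UNIV h" "\<And>t. h t \<in> \<int>"
  shows "h s = h t"
proof -
  have "h constant_on UNIV"
  proof (rule continuous_discrete_range_constant)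
    fix x :: real
    have "1 \<le> norm (h y - h x)" if "h y \<noteq> h x" for y
      using assms(2)[of y] assms(2)[of x] that
      by (metis Ints_diff Ints_nonzero_abs_ge1 eq_iff_diff_eq_0 real_norm_def)
    thus "\<exists>e>0. \<forall>y. y \<in> UNIV \<and> h y \<noteq> h x \<longrightarrow> e \<le> norm (h y - h x)"
      by (intro exI[of _ 1]) auto
  qed (use assms in auto)
  thus ?thesis by (auto simp: constant_on_def)
qed

lemma ex1_circle_degree:
  assumes "continuous_map circle circle f"
  shows "\<exists>!d. \<exists>F. lift_with_degree f F d"
proof -
  have cf: "continuous_on (sphere 0 1) f" and nf: "\<And>z. norm z = 1 \<Longrightarrow> norm (f z) = 1"
    using assms by (auto simp: continuous_map_iff_continuous dest: continuous_map_funspace)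
  have "continuous_on UNIV (\<lambda>t. f (cis (2 * pi * t)))"
    by (rule continuous_on_compose2[OF cf]) (auto intro!: continuous_intros)
  moreover have "f (cis (2 * pi * t)) \<noteq> 0" for t
    using nf[of "cis (2 * pi * t)"] by auto
  ultimately obtain g where g: "continuous_on UNIV g"
      "\<And>t::real. f (cis (2 * pi * t)) = exp (g t)"
    using continuous_logarithm_on_contractible[of UNIV "\<lambda>t. f (cis (2 * pi * t))"]
    by (metis UNIV_I convex_UNIV convex_imp_contractible)
  define F where "F = (\<lambda>t. Im (g t) / (2 * pi))"
  have contF: "continuous_on UNIV F"
    unfolding F_def by (intro continuous_intros g) auto
  have lift: "f (cis (2 * pi * t)) = cis (2 * pi * F t)" for t
  proof -
    have "norm (exp (g t)) = 1"
      using g(2)[of t] nf[of "cis (2 * pi * t)"] by simp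
    hence "Re (g t) = 0" by simp
    thus ?thesis by (simp add: g(2) F_def exp_eq_polar)
  qed
  have per: "cis (2 * pi * (t + 1)) = cis (2 * pi * t)" for t
    by (simp add: distrib_left flip: cis_mult)
  have int: "F (t + 1) - F t \<in> \<int>" for t
    using lift[of "t + 1"] lift[of t] per[of t] by (intro cis_eq_imp_diff_Ints) simp
  have "continuous_on UNIV (\<lambda>t. F (t + 1) - F t)"
    by (intro continuous_intros continuous_on_compose2[OF contF]) auto
  hence const: "F (t + 1) - F t = F (0 + 1) - F 0" for t
    using int by (rule continuous_Ints_constant)
  obtain d where "F (0 + 1) - F 0 = of_int d"
    using int[of 0] by (auto elim: Ints_cases)
  hence "lift_with_degree f F d"
    using contF lift const by (auto simp: lift_with_degree_def algebra_simps)
  moreover have "d' = e'" if "lift_with_degree f G d'" "lift_with_degree f H e'" for G H d' e'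
  proof -
    have "G t - H t \<in> \<int>" for t
      using that by (intro cis_eq_imp_diff_Ints) (metis lift_with_degree_def)
    moreover have "continuous_on UNIV (\<lambda>t. G t - H t)"
      using that by (auto simp: lift_with_degree_def intro!: continuous_intros)
    ultimately have "G (0 + 1) - H (0 + 1) = G 0 - H 0"
      using continuous_Ints_constant[of "\<lambda>t. G t - H t" "0 + 1" 0] by blast
    moreover have "G (0 + 1) = G 0 + of_int d'" "H (0 + 1) = H 0 + of_int e'"
      using that unfolding lift_with_degree_def by blast+
    ultimately have "real_of_int d' = of_int e'" by linarith
    thus ?thesis by simp
  qed
  ultimately show ?thesis by blast
qed

end

theory Submission
  imports Defs
begin

text \<open>The degree classifies circle maps up to free homotopy, and it can be read off any lift \<open>G\<close> to
  the line as the increment \<open>G 1 - G 0\<close> (\<open>homotopic_imp_lift_same_degree\<close>,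
  \<open>lift_same_degree_imp_homotopic\<close>). So the minimal multiplicity of \<open>f\<close> depends only on the
  degree \<open>d\<close>, and it remains to bound the multiplicity of every map of degree \<open>d\<close> from below and
  to exhibit a map attaining the bound.

  The lower bound comes from the intermediate value theorem. If \<open>d \<noteq> 0\<close>, then \<open>G\<close> takes on
  \<open>[0,1)\<close> the \<open>\<bar>d\<bar>\<close> values \<open>G 0, G 0 \<plusminus> 1, \<dots>, G 0 \<plusminus> (\<bar>d\<bar> - 1)\<close>, all of which are sent to the same point
  of the circle (\<open>multiplicity_ge_degree\<close>). If \<open>d = 0\<close>, then \<open>G\<close> descends to a continuous
  real function on the circle, and such a function cannot be injective (\<open>multiplicity_ge_2\<close>).

  The bound is attained by \<open>z \<mapsto> z\<^sup>d\<close> when \<open>d \<noteq> 0\<close>. When \<open>d = 0\<close> it is attained by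
  \<open>z \<mapsto> exp (i Re z)\<close>, which folds the circle onto a diameter and wraps that diameter injectively
  into the circle.\<close>

section \<open>Homotopy classes and lifts\<close>

lemma circle_degree_eqI:
  assumes "continuous_map circle circle f" "lift_with_degree f F d"
  shows "circle_degree f = d"
  unfolding circle_degree_def
  using ex1_circle_degree[OF assms(1)] assms(2) by (intro the1_equality) auto

lemma obtain_lift:
  assumes "continuous_map circle circle f"
  obtains F where "lift_with_degree f F (circle_degree f)"
  using ex1_circle_degree[OF assms] circle_degree_eqI[OF assms] by metis

lemma cis_Arg2pi: "norm z = 1 \<Longrightarrow> cis (Arg2pi z) = z"
  using complex_norm_eq_1_exp[of z] by (simp add: cis_conv_exp)

lemma cis_add_2pi_int: "cis (2 * pi * (x + of_int d)) = cis (2 * pi * x)"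
  by (simp add: distrib_left cis_multiple_2pi flip: cis_mult)

text \<open>If \<open>f\<close> is homotopic to \<open>g\<close>, then the quotient \<open>g / f\<close> is inessential and hence of the form
  \<open>exp (i h)\<close> for a real function \<open>h\<close> on the circle. Adding \<open>h\<close> (up to scale) to a lift of \<open>f\<close>
  gives a lift of \<open>g\<close>, and the increment is unchanged because \<open>h\<close> is periodic along the covering.\<close>

lemma homotopic_imp_lift_same_degree:
  assumes "homotopic_with (\<lambda>_. True) circle circle f g" and F: "lift_with_degree f F d"
  shows "\<exists>G. lift_with_degree g G d"
proof -
  have f: "f z \<noteq> 0" if "norm z = 1" for z
    using continuous_map_funspace[of circle circle f]
      homotopic_with_imp_continuous_maps[OF assms(1)] that by (force simp: Pi_iff)
  obtain h where h: "continuous_on (sphere 0 1) h"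
      "\<And>z. norm z = 1 \<Longrightarrow> g z / f z = exp (\<i> * of_real (h z))"
    using homotopic_with_symD[OF assms(1)] homotopic_circlemaps_divide[of "sphere 0 1" g f]
      inessential_eq_continuous_logarithm_circle[of "sphere 0 1" "\<lambda>z. g z / f z"]
    by auto
  define G where "G = (\<lambda>t. F t + h (cis (2 * pi * t)) / (2 * pi))"
  have "continuous_on UNIV (\<lambda>t. h (cis (2 * pi * t)))"
    by (rule continuous_on_compose2[OF h(1)]) (auto intro!: continuous_intros)
  hence "continuous_on UNIV G"
    using F unfolding G_def lift_with_degree_def by (intro continuous_intros) auto
  moreover have "g (cis (2 * pi * t)) = cis (2 * pi * G t)" for t
  proof -
    have "g (cis (2 * pi * t)) = f (cis (2 * pi * t)) * cis (h (cis (2 * pi * t)))"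
      using h(2)[of "cis (2 * pi * t)"] f[of "cis (2 * pi * t)"]
      by (simp add: cis_conv_exp field_simps)
    also have "\<dots> = cis (2 * pi * G t)"
      using F by (simp add: lift_with_degree_def G_def distrib_left cis_mult)
    finally show ?thesis .
  qed
  moreover have "G (t + 1) = G t + of_int d" for t
    using F cis_add_2pi_int[of t 1] by (simp add: G_def lift_with_degree_def)
  ultimately show ?thesis
    unfolding lift_with_degree_def by blast
qed

text \<open>The straight-line homotopy between two lifts with the same increment passes only through
  functions with that increment, so it projects to a homotopy of loops.\<close>

lemma lift_same_degree_imp_homotopic:
  assumes F: "lift_with_degree f F d" and G: "lift_with_degree g G d"
  shows "homotopic_with (\<lambda>_. True) circle circle f g"
proof -
  have cF: "continuous_on UNIV F" and cG: "continuous_on UNIV G"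
    using F G by (auto simp: lift_with_degree_def)
  have F1: "F 1 = F 0 + of_int d" and G1: "G 1 = G 0 + of_int d"
    using F G unfolding lift_with_degree_def by (metis add_0)+
  define h where "h = (\<lambda>(s, t). cis (2 * pi * ((1 - s) * F t + s * G t)))"
  have "continuous_on ({0..1} \<times> {0..1}) h"
    unfolding h_def case_prod_unfold
    by (intro continuous_intros continuous_on_compose2[OF cF] continuous_on_compose2[OF cG]) auto
  moreover have "h (s, 1) = h (s, 0)" for s
  proof -
    have "(1 - s) * F 1 + s * G 1 = ((1 - s) * F 0 + s * G 0) + of_int d"
      by (simp add: F1 G1 algebra_simps)
    thus ?thesis
      by (simp add: h_def cis_add_2pi_int)
  qed
  ultimately have "homotopic_loops (sphere 0 1)
      (\<lambda>t. cis (2 * pi * F t)) (\<lambda>t. cis (2 * pi * G t))"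
    unfolding homotopic_loops
    by (intro exI[of _ h]) (auto simp: h_def pathfinish_def pathstart_def)
  from homotopic_loops_imp_homotopic_circlemaps[OF this] show ?thesis
  proof (rule homotopic_with_eq)
    have lift: "\<phi> z = cis (2 * pi * \<Phi> (Arg2pi z / (2 * pi)))"
      if "lift_with_degree \<phi> \<Phi> d" "norm z = 1" for \<phi> \<Phi> z
    proof -
      have "\<phi> (cis (2 * pi * (Arg2pi z / (2 * pi)))) = cis (2 * pi * \<Phi> (Arg2pi z / (2 * pi)))"
        using that(1) unfolding lift_with_degree_def by blast
      thus ?thesis
        using that(2) by (simp add: cis_Arg2pi)
    qed
    show "f z = ((\<lambda>t. cis (2 * pi * F t)) \<circ> (\<lambda>z. Arg2pi z / (2 * pi))) z"
      if "z \<in> topspace circle" for z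
      using lift[OF F] that by simp
    show "g z = ((\<lambda>t. cis (2 * pi * G t)) \<circ> (\<lambda>z. Arg2pi z / (2 * pi))) z"
      if "z \<in> topspace circle" for z
      using lift[OF G] that by simp
  qed auto
qed

section \<open>Lower bounds\<close>

lemma card_le_ecard:
  assumes "B \<subseteq> A"
  shows "enat (card B) \<le> ecard A"
  using assms by (auto simp: ecard_def card_mono)

text \<open>Points of a fundamental domain \<open>[0,1)\<close> at which the lift agrees modulo \<open>1\<close> are distinct points
  of a common fibre.\<close>

lemma card_le_multiplicity:
  assumes G: "lift_with_degree g G d" and T: "T \<subseteq> {0..<1}"
    and val: "\<And>t. t \<in> T \<Longrightarrow> \<exists>k. G t = c + of_int k"
  shows "enat (card T) \<le> multiplicity_map circle circle g"
proof -
  let ?e = "\<lambda>t. cis (2 * pi * t)"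
  have "inj_on ?e T"
  proof (rule inj_onI)
    fix s t assume "s \<in> T" "t \<in> T" "?e s = ?e t"
    then obtain k where k: "s - t = of_int k"
      using cis_eq_imp_diff_Ints by (auto elim!: Ints_cases)
    moreover have "\<bar>s - t\<bar> < 1"
      using subsetD[OF T \<open>s \<in> T\<close>] subsetD[OF T \<open>t \<in> T\<close>] by (simp add: abs_less_iff)
    ultimately show "s = t"
      by (simp flip: of_int_abs)
  qed
  moreover have "g (?e t) = ?e c" if t: "t \<in> T" for t
  proof -
    obtain k where "G t = c + of_int k"
      using val[OF t] by blast
    moreover have "g (?e t) = cis (2 * pi * G t)"
      using G by (auto simp: lift_with_degree_def)
    ultimately show ?thesis
      by (simp add: cis_add_2pi_int)
  qed
  hence "?e ` T \<subseteq> {z \<in> topspace circle. g z = ?e c}"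
    by auto
  from card_le_ecard[OF this]
  have "enat (card (?e ` T)) \<le> ecard {z \<in> topspace circle. g z = ?e c}" .
  ultimately have "enat (card T) \<le> ecard {z \<in> topspace circle. g z = ?e c}"
    by (simp only: card_image)
  thus ?thesis
    unfolding multiplicity_map_def by (intro SUP_upper2[of "?e c"]) auto
qed

text \<open>The values of the lift on \<open>[0,1]\<close> cover the segment from \<open>G 0\<close> to \<open>G 0 + d\<close>. Among the
  \<open>\<bar>d\<bar> + 1\<close> translates of \<open>G 0\<close> by integers in it, the last one may be taken only at \<open>1\<close>, which is
  the same point of the circle as \<open>0\<close>; the other \<open>\<bar>d\<bar>\<close> are taken in \<open>[0,1)\<close>.\<close>

lemma multiplicity_ge_degree:
  assumes G: "lift_with_degree g G d"
  shows "enat (nat \<bar>d\<bar>) \<le> multiplicity_map circle circle g"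
proof -
  have cG: "continuous_on S G" for S
    using G continuous_on_subset by (auto simp: lift_with_degree_def)
  have G1: "G 1 = G 0 + of_int d"
    using G unfolding lift_with_degree_def by (metis add_0)
  have "\<exists>t\<in>{0..<1}. G t = G 0 + of_int (sgn d * int k)" if "k < nat \<bar>d\<bar>" for k
  proof -
    have "G 0 + of_int (sgn d * int k) \<in> closed_segment (G 0) (G 1)"
      using that by (auto simp: G1 closed_segment_eq_real_ivl sgn_if)
    then obtain t where t: "t \<in> closed_segment 0 1" "G t = G 0 + of_int (sgn d * int k)"
      using IVT'_closed_segment_real cG by metis
    moreover have "sgn d * int k \<noteq> d"
      using that by (auto simp: sgn_if split: if_splits)
    hence "t \<noteq> 1"
      using t(2) G1 by force
    ultimately show ?thesis
      by (auto simp: closed_segment_eq_real_ivl)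
  qed
  then obtain t where t: "\<And>k. k < nat \<bar>d\<bar> \<Longrightarrow> t k \<in> {0..<1::real}"
      "\<And>k. k < nat \<bar>d\<bar> \<Longrightarrow> G (t k) = G 0 + of_int (sgn d * int k)"
    by metis
  have "inj_on t {..<nat \<bar>d\<bar>}"
  proof (rule inj_onI)
    fix j k assume "j \<in> {..<nat \<bar>d\<bar>}" "k \<in> {..<nat \<bar>d\<bar>}" "t j = t k"
    hence "real_of_int (sgn d * int j) = real_of_int (sgn d * int k)" "d \<noteq> 0"
      using t(2)[of j] t(2)[of k] by auto
    thus "j = k"
      unfolding of_int_eq_iff by (auto simp: sgn_if split: if_splits)
  qed
  hence "card (t ` {..<nat \<bar>d\<bar>}) = nat \<bar>d\<bar>"
    by (simp add: card_image)
  moreover have "enat (card (t ` {..<nat \<bar>d\<bar>})) \<le> multiplicity_map circle circle g"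
  proof (rule card_le_multiplicity[OF G])
    show "t ` {..<nat \<bar>d\<bar>} \<subseteq> {0..<1}"
      using t(1) by auto
    show "\<exists>k. G s = G 0 + of_int k" if "s \<in> t ` {..<nat \<bar>d\<bar>}" for s
      using that t(2) by blast
  qed
  ultimately show ?thesis
    by simp
qed

text \<open>A periodic lift takes equal values at \<open>0\<close> and \<open>1\<close>. Unless its value at \<open>1/2\<close> is also the
  same, it passes the intermediate value once on each half of the period.\<close>

lemma multiplicity_ge_2:
  assumes G: "lift_with_degree g G 0"
  shows "2 \<le> multiplicity_map circle circle g"
proof -
  have cG: "continuous_on S G" for S
    using G continuous_on_subset by (auto simp: lift_with_degree_def)
  have G1: "G 1 = G 0"
    using G unfolding lift_with_degree_def by (metis add_0 of_int_0 add_0_right)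
  have "\<exists>s t. 0 \<le> s \<and> s < t \<and> t < 1 \<and> G s = G t"
  proof (cases "G (1/2) = G 0")
    case True
    thus ?thesis
      by (intro exI[of _ 0] exI[of _ "1/2"]) auto
  next
    case False
    define v where "v = (G 0 + G (1/2)) / 2"
    have v: "v \<noteq> G 0" "v \<noteq> G (1/2)" "v \<in> closed_segment (G 0) (G (1/2))"
        "v \<in> closed_segment (G (1/2)) (G 1)"
      using False by (auto simp: v_def G1 closed_segment_eq_real_ivl)
    obtain s where s: "s \<in> closed_segment 0 (1/2)" "G s = v"
      using IVT'_closed_segment_real[OF v(3) cG] by blast
    obtain t where t: "t \<in> closed_segment (1/2) 1" "G t = v"
      using IVT'_closed_segment_real[OF v(4) cG] by blast
    have "s \<noteq> 1/2" "t \<noteq> 1/2" "t \<noteq> 1"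
      using s(2) t(2) v(1,2) G1 by metis+
    thus ?thesis
      using s t by (intro exI[of _ s] exI[of _ t]) (auto simp: closed_segment_eq_real_ivl)
  qed
  then obtain s t where st: "0 \<le> s" "s < t" "t < 1" "G s = G t"
    by blast
  have "enat (card {s, t}) \<le> multiplicity_map circle circle g"
  proof (rule card_le_multiplicity[OF G])
    show "\<exists>k. G r = G t + of_int k" if "r \<in> {s, t}" for r
      using that st(4) by (intro exI[of _ 0]) auto
  qed (use st in auto)
  thus ?thesis
    using st(2) by (simp add: numeral_eq_enat numeral_2_eq_2)
qed

section \<open>Maps attaining the bounds\<close>

lemma lift_power_int: "lift_with_degree (\<lambda>z. z powi d) (\<lambda>t. of_int d * t) d"
  by (auto simp: lift_with_degree_def cis_power_int algebra_simps intro!: continuous_intros)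

lemma multiplicity_power_int_le:
  assumes "d \<noteq> 0"
  shows "multiplicity_map circle circle (\<lambda>z. z powi d) \<le> enat (nat \<bar>d\<bar>)"
  unfolding multiplicity_map_def
proof (rule SUP_least)
  fix y :: complex assume "y \<in> topspace circle"
  hence "y \<noteq> 0"
    by auto
  \<comment> \<open>For negative \<open>d\<close>, the fibre over \<open>y\<close> consists of the \<open>\<bar>d\<bar>\<close>-th roots of \<open>1 / y\<close>.\<close>
  define c where "c = (if d > 0 then y else inverse y)"
  let ?n = "nat \<bar>d\<bar>"
  have roots: "card {z. z ^ ?n = c} = ?n"
    using assms \<open>y \<noteq> 0\<close> by (intro card_nth_roots) (auto simp: c_def)
  hence fin: "finite {z. z ^ ?n = c}"
    using assms by (intro card_ge_0_finite) simp
  have sub: "{z \<in> topspace circle. z powi d = y} \<subseteq> {z. z ^ ?n = c}"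
    using assms by (auto simp: c_def power_int_def power_inverse)
  show "ecard {z \<in> topspace circle. z powi d = y} \<le> enat ?n"
    using card_mono[OF fin sub] finite_subset[OF sub fin] roots by (simp add: ecard_def)
qed

lemma lift_cis_Re: "lift_with_degree (\<lambda>z. cis (Re z)) (\<lambda>t. cos (2 * pi * t) / (2 * pi)) 0"
proof -
  have "cos (2 * pi * (t + 1)) = cos (2 * pi * t)" for t :: real
    by (simp add: distrib_left)
  thus ?thesis
    by (auto simp: lift_with_degree_def intro!: continuous_intros)
qed

lemma multiplicity_cis_Re_le: "multiplicity_map circle circle (\<lambda>z. cis (Re z)) \<le> 2"
  unfolding multiplicity_map_def
proof (rule SUP_least)
  fix y :: complex
  let ?A = "{z \<in> topspace circle. cis (Re z) = y}"
  show "ecard ?A \<le> 2"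
  proof (cases "?A = {}")
    case True
    thus ?thesis unfolding True by (simp add: ecard_def flip: zero_enat_def)
  next
    case False
    then obtain w where w: "norm w = 1" "cis (Re w) = y"
      by auto
    have "z \<in> {w, cnj w}" if "norm z = 1" "cis (Re z) = y" for z
    proof -
      \<comment> \<open>Real parts on the unit circle differ by at most \<open>2\<close>, less than the period of \<open>cis\<close>.\<close>
      have "cis (2 * pi * (Re z / (2 * pi))) = cis (2 * pi * (Re w / (2 * pi)))"
        using w that by simp
      from cis_eq_imp_diff_Ints[OF this] obtain k where
        "Re z / (2 * pi) - Re w / (2 * pi) = of_int k"
        by (auto elim: Ints_cases)
      hence k: "Re z - Re w = 2 * pi * of_int k"
        by (simp add: field_simps)
      have "\<bar>Re z - Re w\<bar> < 2 * pi"
        using abs_Re_le_cmod[of z] abs_Re_le_cmod[of w] w(1) that(1) pi_gt3 by linarith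
      hence "2 * pi * \<bar>real_of_int k\<bar> < 2 * pi * 1"
        by (simp add: k abs_mult)
      hence "k = 0"
        by (subst (asm) mult_less_cancel_left_pos) (auto simp flip: of_int_abs)
      hence Re: "Re z = Re w"
        using k by simp
      hence "(Im z)\<^sup>2 = (Im w)\<^sup>2"
        using that(1) w(1) cmod_power2[of z] cmod_power2[of w] by simp
      thus ?thesis
        using Re by (auto simp: complex_eq_iff power2_eq_iff)
    qed
    hence sub: "?A \<subseteq> {w, cnj w}"
      by auto
    have "card ?A \<le> card {w, cnj w}"
      using sub by (intro card_mono) auto
    also have "\<dots> \<le> 2"
      by (simp add: card_insert_if)
    finally have "enat (card ?A) \<le> 2"
      by (simp add: numeral_eq_enat)
    thus ?thesis
      using finite_subset[OF sub] by (simp only: ecard_def) auto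
  qed
qed

section \<open>The minimal multiplicity\<close>

theorem theorem2p1:
  fixes f :: "complex \<Rightarrow> complex"
  assumes "continuous_map circle circle f"
  shows "MMR circle circle f =
    (if circle_degree f \<noteq> 0 then enat (nat \<bar>circle_degree f\<bar>) else 2)"
proof -
  define d where "d = circle_degree f"
  obtain F where F: "lift_with_degree f F d"
    using obtain_lift[OF assms] unfolding d_def .
  have lower: "m \<le> MMR circle circle f"
    if "\<And>g G. lift_with_degree g G d \<Longrightarrow> m \<le> multiplicity_map circle circle g" for m
    unfolding MMR_def using that homotopic_imp_lift_same_degree[OF _ F]
    by (intro INF_greatest) blast
  have upper: "MMR circle circle f \<le> m"
    if "lift_with_degree g G d" "multiplicity_map circle circle g \<le> m" for g G m
    unfolding MMR_def using that lift_same_degree_imp_homotopic[OF F]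
    by (intro INF_lower2[of g]) auto
  have "MMR circle circle f = (if d \<noteq> 0 then enat (nat \<bar>d\<bar>) else 2)"
  proof (cases "d = 0")
    case True
    have "MMR circle circle f = 2"
    proof (rule antisym)
      show "MMR circle circle f \<le> 2"
        using lift_cis_Re multiplicity_cis_Re_le upper True by blast
      show "2 \<le> MMR circle circle f"
        using multiplicity_ge_2 True by (intro lower) blast
    qed
    thus ?thesis
      using True by simp
  next
    case False
    have "MMR circle circle f = enat (nat \<bar>d\<bar>)"
    proof (rule antisym)
      show "MMR circle circle f \<le> enat (nat \<bar>d\<bar>)"
        using lift_power_int multiplicity_power_int_le[OF False] by (rule upper)
      show "enat (nat \<bar>d\<bar>) \<le> MMR circle circle f"
        using multiplicity_ge_degree by (rule lower)
    qed
    thus ?thesis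
      using False by simp
  qed
  thus ?thesis
    unfolding d_def .
qed

end
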